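(* Let $(X,T)$ be a non-trivial (i.e. $X$ has at least two points) totally transitive dynamical system. If there exists a subsystem $(Y,T)$ of $(X,T)$ such that $(X\times Y,T\times T)$ is transitive, then $(X,T)$ is non-classical Li-Yorke chaotic, that is, $(r,s)$-Li-Yorke chaotic for any $r,s\in\mathbb{N}$.
   Context: A dynamical system $(X,T)$ is a compact metric space $(X,\rho)$ with a continuous map $T\colon X\to X$. $\mathbb{N}$ is the set of positive integers. $(X,T)$ is transitive if for all non-empty open $U,V\subset X$ there is $n\in\mathbb{N}$ with $U\cap T^{-n}V\neq\emptyset$; it is totally transitive if $(X,T^n)$ is transitive for every $n\in\mathbb{N}$. A subsystem is $(Y,T)$ with $Y\subset X$ non-empty closed and $T(Y)\subset Y$. For $r,s\in\mathbb{N}$, a pair $(x,y)\in X\times X$ is $(r,s)$-scrambled if $\liminf_{n\to\infty}\rho(T^{rn}x,T^{sn}y)=0$ and $\limsup_{n\to\infty}\rho(T^{rn}x,T^{sn}y)>0$. A subset $C\subset X$ is $(r,s)$-scrambled if any two distinct points $x,y\in C$ form an $(r,s)$-scrambled pair $(x,y)$. $(X,T)$ is $(r,s)$-Li-Yorke chaotic if there is an uncountable $(r,s)$-scrambled set in $X$. *)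

theory Defs
  imports "HOL-Analysis.Analysis"
begin

text \<open>A system is a compact subset \<open>X\<close> of a metric space with a self-map that is continuous on
  \<open>X\<close>; values of \<open>T\<close> outside \<open>X\<close> play no role. Open and closed subsets of \<open>X\<close> are relative to the
  subspace topology.\<close>

definition dynamical_system :: "'a::metric_space set \<Rightarrow> ('a \<Rightarrow> 'a) \<Rightarrow> bool" where
  "dynamical_system X T \<longleftrightarrow> compact X \<and> continuous_on X T \<and> T ` X \<subseteq> X"

definition transitive_system :: "'a::metric_space set \<Rightarrow> ('a \<Rightarrow> 'a) \<Rightarrow> bool" where
  "transitive_system X T \<longleftrightarrow>
     (\<forall>U V. openin (top_of_set X) U \<longrightarrow> U \<noteq> {} \<longrightarrow> openin (top_of_set X) V \<longrightarrow> V \<noteq> {} \<longrightarrow>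
        (\<exists>n\<ge>1. U \<inter> (T ^^ n) -` V \<noteq> {}))"

definition totally_transitive_system :: "'a::metric_space set \<Rightarrow> ('a \<Rightarrow> 'a) \<Rightarrow> bool" where
  "totally_transitive_system X T \<longleftrightarrow> (\<forall>n\<ge>1. transitive_system X (T ^^ n))"

definition subsystem :: "'a::metric_space set \<Rightarrow> 'a set \<Rightarrow> ('a \<Rightarrow> 'a) \<Rightarrow> bool" where
  "subsystem Y X T \<longleftrightarrow> Y \<noteq> {} \<and> closedin (top_of_set X) Y \<and> T ` Y \<subseteq> Y"

text \<open>The distances are embedded into \<^typ>\<open>ereal\<close> because the limits inferior and superior
  are defined on complete lattices.\<close>

definition scrambled_pair ::
  "('a::metric_space \<Rightarrow> 'a) \<Rightarrow> nat \<Rightarrow> nat \<Rightarrow> 'a \<Rightarrow> 'a \<Rightarrow> bool" where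
  "scrambled_pair T r s x y \<longleftrightarrow>
     liminf (\<lambda>n. ereal (dist ((T ^^ (r * n)) x) ((T ^^ (s * n)) y))) = 0 \<and>
     limsup (\<lambda>n. ereal (dist ((T ^^ (r * n)) x) ((T ^^ (s * n)) y))) > 0"

definition scrambled_set ::
  "'a::metric_space set \<Rightarrow> ('a \<Rightarrow> 'a) \<Rightarrow> nat \<Rightarrow> nat \<Rightarrow> 'a set \<Rightarrow> bool" where
  "scrambled_set X T r s C \<longleftrightarrow>
     C \<subseteq> X \<and> (\<forall>x\<in>C. \<forall>y\<in>C. x \<noteq> y \<longrightarrow> scrambled_pair T r s x y)"

definition Li_Yorke_chaotic ::
  "'a::metric_space set \<Rightarrow> ('a \<Rightarrow> 'a) \<Rightarrow> nat \<Rightarrow> nat \<Rightarrow> bool" where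
  "Li_Yorke_chaotic X T r s \<longleftrightarrow> (\<exists>C. uncountable C \<and> scrambled_set X T r s C)"

definition nonclassical_Li_Yorke_chaotic ::
  "'a::metric_space set \<Rightarrow> ('a \<Rightarrow> 'a) \<Rightarrow> bool" where
  "nonclassical_Li_Yorke_chaotic X T \<longleftrightarrow> (\<forall>r\<ge>1. \<forall>s\<ge>1. Li_Yorke_chaotic X T r s)"

end

theory Submission
  imports Defs
begin

text \<open>By Mycielski's theorem it suffices that proximality and non-asymptoticity hold on a dense
  \<open>G\<^sub>\<delta>\<close> set of pairs, the space being perfect. For \<open>r < s\<close>, total transitivity alone gives density:
  if \<open>x = (T ^^ ((s - r) * n)) y\<close>, then \<open>(T ^^ (r * n)) x = (T ^^ (s * n)) y\<close>. For \<open>r = s\<close>,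
  transitivity of \<open>X \<times> Y\<close> yields \<open>k\<close> with \<open>U\<close> meeting \<open>V\<close> at time \<open>k\<close> while some point of \<open>Y\<close> is
  moved only slightly by \<open>T ^^ k\<close>; steering \<open>x\<close> close to that point makes \<open>x\<close> and \<open>(T ^^ k) x\<close>
  proximal, and recurrence of such pairs prevents them from being asymptotic.\<close>

section \<open>Baire category and Mycielski's theorem in compact metric spaces\<close>

lemma compact_Baire:
  fixes X :: "'a::metric_space set"
  assumes "compact X" "countable \<G>"
    and "\<And>G. G \<in> \<G> \<Longrightarrow> openin (top_of_set X) G"
    and "\<And>G U. \<lbrakk>G \<in> \<G>; openin (top_of_set X) U; U \<noteq> {}\<rbrakk> \<Longrightarrow> G \<inter> U \<noteq> {}"
    and "openin (top_of_set X) U" "U \<noteq> {}"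
  shows "\<exists>x\<in>U. \<forall>G\<in>\<G>. x \<in> G"
proof -
  have "compact_space (top_of_set X)" "Hausdorff_space (top_of_set X)"
    using \<open>compact X\<close> by (auto simp: compact_space_subtopology compactin_euclidean_iff
        Hausdorff_space_subtopology)
  \<comment> \<open>The ambient type is not assumed complete, so Baire's theorem is used in its
    locally compact regular form.\<close>
  then have "locally_compact_space (top_of_set X) \<and> regular_space (top_of_set X)"
    by (simp add: compact_imp_locally_compact_space compact_Hausdorff_imp_regular_space)
  moreover have "openin (top_of_set X) G \<and> top_of_set X closure_of G = topspace (top_of_set X)"
    if "G \<in> \<G>" for G
    using assms(3,4)[OF that] unfolding dense_intersects_open by blast
  ultimately have "top_of_set X closure_of \<Inter>\<G> = topspace (top_of_set X)"
    by (intro Baire_category[OF _ \<open>countable \<G>\<close>]) auto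
  then have "\<Inter>\<G> \<inter> U \<noteq> {}"
    using assms(5,6) unfolding dense_intersects_open by blast
  then show ?thesis by blast
qed

text \<open>Total boundedness covers \<open>X\<close> by finitely many balls of each radius
  \<open>inverse (Suc n)\<close>. The traces on \<open>X\<close> of all these balls form the family:
  one of them that contains a given point of \<open>U\<close> lies in \<open>U\<close> once its
  radius is small.\<close>

lemma compact_countable_pi_base:
  fixes X :: "'a::metric_space set"
  assumes "compact X"
  obtains \<B> where "countable \<B>" "\<And>B. B \<in> \<B> \<Longrightarrow> openin (top_of_set X) B" "{} \<notin> \<B>"
    "\<And>U. \<lbrakk>openin (top_of_set X) U; U \<noteq> {}\<rbrakk> \<Longrightarrow> \<exists>B\<in>\<B>. B \<subseteq> U"
proof -
  have "\<exists>D. finite D \<and> X \<subseteq> (\<Union>d\<in>D. ball d (inverse (Suc n)))" for n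
    using assms unfolding compact_eq_totally_bounded by simp
  then obtain D where D: "\<And>n. finite (D n)" "\<And>n. X \<subseteq> (\<Union>d\<in>D n. ball d (inverse (Suc n)))"
    by metis
  \<comment> \<open>The centres may lie outside \<open>X\<close>, so traces can be empty. They are
    removed because no set can meet the empty set, and density is tested on this family.\<close>
  define \<B> where "\<B> = (\<Union>n. (\<lambda>d. X \<inter> ball d (inverse (Suc n))) ` D n) - {{}}"
  show thesis
  proof
    show "countable \<B>"
      unfolding \<B>_def using D(1) by (intro countable_Diff countable_UN) (auto intro: countable_finite)
    show "openin (top_of_set X) B" if "B \<in> \<B>" for B
      using that by (auto simp: \<B>_def openin_open_Int)
    show "{} \<notin> \<B>" by (simp add: \<B>_def)
    fix U assume U: "openin (top_of_set X) U" "U \<noteq> {}"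
    then obtain x where "x \<in> U" by blast
    then have "x \<in> X" using openin_imp_subset[OF U(1)] by blast
    obtain e where e: "e > 0" "ball x e \<inter> X \<subseteq> U"
      using U(1) \<open>x \<in> U\<close> unfolding openin_contains_ball by blast
    obtain n where n: "inverse (Suc n) < e / 2"
      using reals_Archimedean[of "e/2"] \<open>e > 0\<close> by auto
    obtain d where d: "d \<in> D n" "dist d x < inverse (Suc n)"
      using D(2)[of n] \<open>x \<in> X\<close> by (auto simp: mem_ball)
    have "X \<inter> ball d (inverse (Suc n)) \<subseteq> ball x e"
    proof
      fix y assume "y \<in> X \<inter> ball d (inverse (Suc n))"
      then show "y \<in> ball x e"
        using d(2) n dist_triangle[of x y d] by (simp add: dist_commute)
    qed
    moreover have "X \<inter> ball d (inverse (Suc n)) \<in> \<B>"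
      using d \<open>x \<in> X\<close> by (auto simp: \<B>_def)
    ultimately show "\<exists>B\<in>\<B>. B \<subseteq> U" using e(2) by blast
  qed
qed

text \<open>By a Kuratowski--Ulam argument, generic points have dense sections;
  a maximal independent set of such points cannot be countable, since otherwise Baire's theorem
  would extend it.\<close>

lemma Mycielski_sym:
  fixes X :: "'a::metric_space set" and \<R> :: "('a \<times> 'a) set set"
  assumes X: "compact X" "X \<noteq> {}" and perfect: "\<And>x. x \<in> X \<Longrightarrow> \<not> openin (top_of_set X) {x}"
    and \<R>: "countable \<R>"
    and conv: "\<And>R. R \<in> \<R> \<Longrightarrow> R\<inverse> \<in> \<R>"
    and opn: "\<And>R x. \<lbrakk>R \<in> \<R>; x \<in> X\<rbrakk> \<Longrightarrow> openin (top_of_set X) {y\<in>X. (x, y) \<in> R}"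
    and dense: "\<And>R U V. \<lbrakk>R \<in> \<R>; openin (top_of_set X) U; U \<noteq> {};
                  openin (top_of_set X) V; V \<noteq> {}\<rbrakk> \<Longrightarrow> \<exists>x\<in>U. \<exists>y\<in>V. (x, y) \<in> R"
  obtains C where "C \<subseteq> X" "uncountable C"
    "\<And>x y R. \<lbrakk>x \<in> C; y \<in> C; x \<noteq> y; R \<in> \<R>\<rbrakk> \<Longrightarrow> (x, y) \<in> R"
proof -
  obtain \<B> where \<B>: "countable \<B>" "\<And>B. B \<in> \<B> \<Longrightarrow> openin (top_of_set X) B" "{} \<notin> \<B>"
    "\<And>U. \<lbrakk>openin (top_of_set X) U; U \<noteq> {}\<rbrakk> \<Longrightarrow> \<exists>B\<in>\<B>. B \<subseteq> U"
    by (rule compact_countable_pi_base[OF X(1)]) blast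
  define hit where "hit = (\<lambda>(R::('a \<times> 'a) set, V). {x\<in>X. \<exists>y\<in>V. (x, y) \<in> R})"
  have sub: "U \<subseteq> X" if "openin (top_of_set X) U" for U
    using openin_imp_subset[OF that] .
  have hit_open: "openin (top_of_set X) (hit (R, V))" if "R \<in> \<R>" "V \<in> \<B>" for R V
  proof -
    \<comment> \<open>Each set in the union is a section of the converse of \<open>R\<close>, hence
      open by \<open>conv\<close> and \<open>opn\<close>.\<close>
    have "hit (R, V) = (\<Union>y\<in>V. {x\<in>X. (x, y) \<in> R})" by (auto simp: hit_def)
    then show ?thesis
      using opn[OF conv[OF that(1)]] sub[OF \<B>(2)[OF that(2)]] by (auto intro!: openin_Union)
  qed
  have hit_dense: "hit (R, V) \<inter> U \<noteq> {}"
    if "R \<in> \<R>" "V \<in> \<B>" "openin (top_of_set X) U" "U \<noteq> {}" for R V U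
    using dense[OF that(1,3,4) \<B>(2)[OF that(2)]] that(2) \<B>(3) sub[OF that(3)]
    by (auto simp: hit_def)
  \<comment> \<open>A point is good when its section under every \<open>R\<close> is dense, tested
    on the pi-base. This leaves room, in every non-empty open set, for points related to it.\<close>
  define good where "good = {x\<in>X. \<forall>R\<in>\<R>. \<forall>V\<in>\<B>. \<exists>y\<in>V. (x, y) \<in> R}"
  define I where "I = {C. C \<subseteq> good \<and> (\<forall>x\<in>C. \<forall>y\<in>C. x \<noteq> y \<longrightarrow> (x, y) \<in> \<Inter>\<R>)}"
  have "\<exists>C\<in>I. \<forall>D\<in>I. C \<subseteq> D \<longrightarrow> D = C"
  proof (rule subset_Zorn')
    fix \<C> assume ch: "subset.chain I \<C>"
    show "\<Union>\<C> \<in> I"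
    proof -
      have "\<Union>\<C> \<subseteq> good" using ch by (auto simp: subset.chain_def I_def)
      moreover have "(x, y) \<in> \<Inter>\<R>" if "x \<in> A" "A \<in> \<C>" "y \<in> B" "B \<in> \<C>" "x \<noteq> y" for x y A B
      proof -
        have "A \<subseteq> B \<or> B \<subseteq> A" "A \<in> I" "B \<in> I"
          using ch that(2,4) by (auto simp: subset.chain_def)
        then show ?thesis using that unfolding I_def by blast
      qed
      ultimately show ?thesis unfolding I_def by blast
    qed
  qed
  then obtain C where C: "C \<in> I" and max: "\<And>D. D \<in> I \<Longrightarrow> C \<subseteq> D \<Longrightarrow> D = C" by blast
  have CX: "C \<subseteq> X" using C by (auto simp: I_def good_def)
  have "uncountable C"
  proof
    assume cC: "countable C"
    \<comment> \<open>Three countable families of dense open sets: membership of \<open>z\<close> in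
      the first makes \<open>z\<close> good, in the second relates every \<open>c\<close> in
      \<open>C\<close> to \<open>z\<close>, in the third keeps \<open>z\<close> out of
      \<open>C\<close>. Countability of \<open>C\<close> is what allows Baire's theorem
      here.\<close>
    define \<G> where "\<G> = hit ` (\<R> \<times> \<B>) \<union> (\<lambda>(R, c). {y\<in>X. (c, y) \<in> R}) ` (\<R> \<times> C) \<union> (\<lambda>c. X - {c}) ` C"
    have "\<exists>z\<in>X. \<forall>G\<in>\<G>. z \<in> G"
    proof (rule compact_Baire[OF X(1) _ _ _ _ X(2)])
      show "countable \<G>" unfolding \<G>_def using \<R> \<B>(1) cC by auto
      show "openin (top_of_set X) G" if "G \<in> \<G>" for G
        using that unfolding \<G>_def
      proof (elim UnE imageE)
        fix q assume "G = hit q" "q \<in> \<R> \<times> \<B>"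
        then show ?thesis using hit_open by (cases q) simp
      next
        fix q assume "G = (\<lambda>(R, c). {y\<in>X. (c, y) \<in> R}) q" "q \<in> \<R> \<times> C"
        then show ?thesis using opn CX by (cases q) (simp add: subset_iff)
      next
        fix c assume "G = X - {c}"
        then show ?thesis
          using openin_open_Int[of "- {c}" X] by (simp add: Diff_eq open_Compl)
      qed
      show "G \<inter> U \<noteq> {}" if GU: "G \<in> \<G>" "openin (top_of_set X) U" "U \<noteq> {}" for G U
        using GU(1) unfolding \<G>_def
      proof (elim UnE imageE)
        fix q assume "G = hit q" "q \<in> \<R> \<times> \<B>"
        then show ?thesis using hit_dense GU(2,3) by (cases q) simp
      next
        fix q assume q: "G = (\<lambda>(R, c). {y\<in>X. (c, y) \<in> R}) q" "q \<in> \<R> \<times> C"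
        obtain R c where Pc: "q = (R, c)" "R \<in> \<R>" "c \<in> C" using q(2) by auto
        obtain B where B: "B \<in> \<B>" "B \<subseteq> U" using \<B>(4) GU(2,3) by blast
        have "c \<in> good" using C Pc(3) by (auto simp: I_def)
        then obtain y where "y \<in> B" "(c, y) \<in> R" using Pc(2) B(1) by (auto simp: good_def)
        then have "y \<in> G \<inter> U" using q(1) Pc(1) B(2) sub[OF GU(2)] by auto
        then show ?thesis by blast
      next
        fix c assume c: "G = X - {c}" "c \<in> C"
        have "U \<noteq> {c}" using perfect c(2) CX GU(2) by auto
        then show ?thesis using c(1) sub[OF GU(2)] GU(3) by blast
      qed
    qed simp
    then obtain z where z: "z \<in> X" "\<And>G. G \<in> \<G> \<Longrightarrow> z \<in> G" by blast
    have zC: "z \<notin> C"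
    proof
      assume "z \<in> C"
      then have "X - {z} \<in> \<G>" by (simp add: \<G>_def)
      then show False using z(2) by blast
    qed
    have "z \<in> hit (R, V)" if "R \<in> \<R>" "V \<in> \<B>" for R V
      using that by (intro z(2)) (simp add: \<G>_def)
    then have "z \<in> good" using z(1) by (auto simp: good_def hit_def)
    have cz: "(c, z) \<in> R" if "R \<in> \<R>" "c \<in> C" for R c
    proof -
      have "{y\<in>X. (c, y) \<in> R} \<in> \<G>"
        unfolding \<G>_def using that by (intro UnI1 UnI2 image_eqI[of _ _ "(R, c)"]) auto
      then show ?thesis using z(2) by blast
    qed
    have zc: "(z, c) \<in> R" if "R \<in> \<R>" "c \<in> C" for R c
      using cz[OF conv[OF that(1)] that(2)] by simp
    have "insert z C \<in> I"
      using C \<open>z \<in> good\<close> cz zc unfolding I_def by (simp add: subset_iff)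
    then show False using max[of "insert z C"] zC by blast
  qed
  show thesis
  proof (rule that[OF CX \<open>uncountable C\<close>])
    fix x y R assume "x \<in> C" "y \<in> C" "x \<noteq> y" "R \<in> \<R>"
    then have "(x, y) \<in> \<Inter>\<R>" using C by (auto simp: I_def)
    then show "(x, y) \<in> R" using \<open>R \<in> \<R>\<close> by blast
  qed
qed

text \<open>Adjoining all converses to \<open>\<R>\<close> reduces this to the symmetric version:
  sections of a converse are sections in the other variable, and density passes to it by exchanging
  \<open>U\<close> and \<open>V\<close>.\<close>

lemma Mycielski:
  fixes X :: "'a::metric_space set" and \<R> :: "('a \<times> 'a) set set"
  assumes "compact X" "X \<noteq> {}" "\<And>x. x \<in> X \<Longrightarrow> \<not> openin (top_of_set X) {x}" "countable \<R>"
    and "\<And>R x. \<lbrakk>R \<in> \<R>; x \<in> X\<rbrakk> \<Longrightarrow> openin (top_of_set X) {y\<in>X. (x, y) \<in> R}"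
    and "\<And>R y. \<lbrakk>R \<in> \<R>; y \<in> X\<rbrakk> \<Longrightarrow> openin (top_of_set X) {x\<in>X. (x, y) \<in> R}"
    and dense: "\<And>R U V. \<lbrakk>R \<in> \<R>; openin (top_of_set X) U; U \<noteq> {};
          openin (top_of_set X) V; V \<noteq> {}\<rbrakk> \<Longrightarrow> \<exists>x\<in>U. \<exists>y\<in>V. (x, y) \<in> R"
  obtains C where "C \<subseteq> X" "uncountable C"
    "\<And>x y R. \<lbrakk>x \<in> C; y \<in> C; x \<noteq> y; R \<in> \<R>\<rbrakk> \<Longrightarrow> (x, y) \<in> R"
proof -
  let ?\<R> = "\<R> \<union> converse ` \<R>"
  show thesis
  proof (rule Mycielski_sym[where \<R> = ?\<R>])
    fix R assume "R \<in> ?\<R>"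
    then show "R\<inverse> \<in> ?\<R>" by (force simp: image_iff)
  next
    fix R U V assume R: "R \<in> ?\<R>" and UV: "openin (top_of_set X) U" "U \<noteq> {}"
      "openin (top_of_set X) V" "V \<noteq> {}"
    show "\<exists>x\<in>U. \<exists>y\<in>V. (x, y) \<in> R"
      using R
    proof (elim UnE imageE)
      assume "R \<in> \<R>"
      then show ?thesis by (rule dense[OF _ UV])
    next
      fix Q assume "R = Q\<inverse>" "Q \<in> \<R>"
      then show ?thesis using dense[OF _ UV(3,4) UV(1,2), of Q] by blast
    qed
  next
    fix R x assume "R \<in> ?\<R>" "x \<in> X"
    then show "openin (top_of_set X) {y\<in>X. (x, y) \<in> R}"
      using assms(5,6) by (elim UnE imageE) simp_all
  next
    fix C assume "C \<subseteq> X" "uncountable C"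
      and C: "\<And>x y R. \<lbrakk>x \<in> C; y \<in> C; x \<noteq> y; R \<in> ?\<R>\<rbrakk> \<Longrightarrow> (x, y) \<in> R"
    then show thesis by (intro that[of C] C UnI1)
  qed (use assms(1-4) in simp_all)
qed

section \<open>Criteria for limits inferior and superior, and iterates\<close>

lemma liminf_eq_zeroI:
  fixes f :: "nat \<Rightarrow> real"
  assumes "\<And>n. f n \<ge> 0" "\<And>N. \<exists>n\<ge>N. f n < inverse (Suc N)"
  shows "liminf (\<lambda>n. ereal (f n)) = 0"
proof (rule antisym)
  show "0 \<le> liminf (\<lambda>n. ereal (f n))"
    by (rule Liminf_bounded) (simp add: assms(1))
  show "liminf (\<lambda>n. ereal (f n)) \<le> 0"
  proof (rule ccontr)
    assume "\<not> ?thesis"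
    then obtain e where e: "0 < ereal e" "ereal e < liminf (\<lambda>n. ereal (f n))"
      using ereal_dense2 by (metis not_le)
    then obtain M where M: "\<And>n. n \<ge> M \<Longrightarrow> e < f n"
      using less_LiminfD[OF e(2)] by (auto simp: eventually_sequentially)
    obtain K where K: "inverse (Suc K) < e" using reals_Archimedean e(1) by auto
    \<comment> \<open>The same index bounds both time and tolerance, so \<open>max M K\<close> makes
      \<open>n\<close> late enough for \<open>M\<close> and the value smaller than
      \<open>e\<close>.\<close>
    obtain n where n: "n \<ge> max M K" "f n < inverse (Suc (max M K))" using assms(2) by blast
    have "inverse (Suc (max M K)) \<le> inverse (real (Suc K))"
      by (intro le_imp_inverse_le) auto
    moreover have "e < f n" using M n(1) by simp
    ultimately show False using n(2) K by linarith
  qed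
qed

lemma limsup_posI:
  fixes f :: "nat \<Rightarrow> real"
  assumes "d > 0" "\<And>N. \<exists>n\<ge>N. f n > d"
  shows "limsup (\<lambda>n. ereal (f n)) > 0"
proof (rule ccontr)
  assume "\<not> ?thesis"
  then have "limsup (\<lambda>n. ereal (f n)) < ereal d"
    using assms(1) by (meson ereal_less(2) le_less_trans not_le)
  from Limsup_lessD[OF this] obtain M where "\<And>n. n \<ge> M \<Longrightarrow> f n < d"
    by (auto simp: eventually_sequentially)
  then show False using assms(2)[of M] by force
qed

lemma openin_ex_less:
  fixes g :: "nat \<Rightarrow> 'a::topological_space \<Rightarrow> real"
  assumes "\<And>n. continuous_on X (g n)"
  shows "openin (top_of_set X) {x\<in>X. \<exists>n\<ge>N. g n x < e}"
proof -
  have "{x\<in>X. \<exists>n\<ge>N. g n x < e} = (\<Union>n\<in>{N..}. X \<inter> g n -` {..<e})" by auto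
  moreover have "openin (top_of_set X) (\<Union>n\<in>{N..}. X \<inter> g n -` {..<e})"
    by (rule openin_Union) (use continuous_openin_preimage_gen[OF assms open_lessThan] in blast)
  ultimately show ?thesis by (simp only:)
qed

lemma funpow_add_apply: "(f ^^ (m + n)) x = (f ^^ m) ((f ^^ n) x)"
  by (simp add: funpow_add)

lemma map_prod_funpow:
  fixes f :: "'a \<Rightarrow> 'a" and g :: "'b \<Rightarrow> 'b"
  shows "(map_prod f g ^^ n) (x, y) = ((f ^^ n) x, (g ^^ n) y)"
  by (induction n) auto

lemma openin_ball_Int:
  fixes U :: "'a::metric_space set"
  assumes "openin (top_of_set X) U"
  shows "openin (top_of_set X) (U \<inter> ball a e)"
  using assms by (meson open_ball openin_Int_open)

section \<open>Totally transitive systems and a criterion for chaos\<close>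

locale tt_system =
  fixes X :: "'a::metric_space set" and T :: "'a \<Rightarrow> 'a"
  assumes dyn: "dynamical_system X T"
    and nontrivial: "\<exists>x\<in>X. \<exists>y\<in>X. x \<noteq> y"
    and tt: "totally_transitive_system X T"
begin

lemma compact_nonempty: "compact X" "X \<noteq> {}"
  using dyn nontrivial by (auto simp: dynamical_system_def)

lemma openin_X: "openin (top_of_set X) X"
  by simp

lemma funpow_in: "x \<in> X \<Longrightarrow> (T ^^ n) x \<in> X"
  using dyn by (induction n) (auto simp: dynamical_system_def)

lemma continuous_funpow: "continuous_on X (T ^^ n)"
proof (induction n)
  case (Suc n)
  have "continuous_on ((T ^^ n) ` X) T"
    using dyn funpow_in by (auto simp: dynamical_system_def intro: continuous_on_subset)
  from continuous_on_compose[OF Suc this] show ?case by simp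
qed (simp add: id_def)

lemma openin_preimage:
  assumes "openin (top_of_set X) U" "openin (top_of_set X) V"
  shows "openin (top_of_set X) {x\<in>U. (T ^^ n) x \<in> V}"
proof -
  have "{x\<in>U. (T ^^ n) x \<in> V} = U \<inter> (X \<inter> (T ^^ n) -` V)"
    using openin_imp_subset[OF assms(1)] by auto
  moreover have "openin (top_of_set X) (X \<inter> (T ^^ n) -` V)"
    using continuous_openin_preimage[OF continuous_funpow _ assms(2)] funpow_in by blast
  ultimately show ?thesis using assms(1) by (simp add: openin_Int)
qed

text \<open>Transitivity is applied to the power \<open>k * max N 1\<close>: its hitting times are
  multiples of \<open>max N 1\<close> in the variable \<open>n\<close>, so a late hit along
  multiples of \<open>k\<close> comes for free.\<close>

lemma hits:
  assumes "k \<ge> 1" "openin (top_of_set X) U" "U \<noteq> {}" "openin (top_of_set X) V" "V \<noteq> {}"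
  shows "\<exists>n\<ge>N. n \<ge> 1 \<and> (\<exists>x\<in>U. (T ^^ (k * n)) x \<in> V)"
proof -
  define M where "M = max N 1"
  have "k * M \<ge> 1" using assms(1) by (simp add: M_def)
  then have "transitive_system X (T ^^ (k * M))"
    using tt by (simp add: totally_transitive_system_def)
  then obtain m x where m: "m \<ge> 1" "x \<in> U" "((T ^^ (k * M)) ^^ m) x \<in> V"
    using assms(2-5) unfolding transitive_system_def by blast
  have "M * m \<ge> M" using m(1) by (cases m) auto
  moreover have "(T ^^ (k * (M * m))) x \<in> V"
    using m(3) by (simp add: funpow_mult mult.assoc)
  ultimately show ?thesis
    using m(2) by (intro exI[of _ "M * m"]) (auto simp: M_def)
qed

text \<open>Transitivity would bring an isolated point back to itself after some \<open>n\<close>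
  steps. It would then be fixed by \<open>T ^^ n\<close> and never reach the rest of
  \<open>X\<close>, against transitivity of that power. Transitivity of \<open>T\<close> alone does
  not suffice, as a finite cycle shows.\<close>

lemma no_isolated_point:
  assumes "x \<in> X"
  shows "\<not> openin (top_of_set X) {x}"
proof
  assume op: "openin (top_of_set X) {x}"
  obtain n where n: "n \<ge> 1" "(T ^^ (1 * n)) x = x"
    using hits[OF order_refl op _ op, of 0] by blast
  have "(T ^^ (n * m)) x = x" for m
  proof -
    have "((T ^^ n) ^^ m) x = x" using n(2) by (induction m) auto
    then show ?thesis by (simp add: funpow_mult)
  qed
  moreover have "openin (top_of_set X) (X - {x})"
    using openin_open_Int[of "- {x}" X] by (simp add: Diff_eq open_Compl)
  moreover have "X - {x} \<noteq> {}" using nontrivial by blast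
  ultimately show False using hits[OF n(1) op, of "X - {x}" 0] by auto
qed

text \<open>This serves both \<open>r < s\<close> and \<open>r = s\<close>: \<open>g\<close> and
  \<open>e\<close> encode non-asymptoticity as countably many open conditions on pairs, by means of
  the distance itself in the first case and of recurrence in the second.\<close>

lemma Li_Yorke_chaoticI:
  fixes g :: "nat \<Rightarrow> 'a \<Rightarrow> 'a \<Rightarrow> real" and e :: "nat \<Rightarrow> real"
  assumes cont: "\<And>n x. x \<in> X \<Longrightarrow> continuous_on X (\<lambda>y. g n x y)"
      "\<And>n y. y \<in> X \<Longrightarrow> continuous_on X (\<lambda>x. g n x y)"
    and proximal: "\<And>U V N. \<lbrakk>openin (top_of_set X) U; U \<noteq> {}; openin (top_of_set X) V; V \<noteq> {}\<rbrakk>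
      \<Longrightarrow> \<exists>x\<in>U. \<exists>y\<in>V. \<exists>n\<ge>N. dist ((T ^^ (r * n)) x) ((T ^^ (s * n)) y) < inverse (Suc N)"
    and dense: "\<And>U V N. \<lbrakk>openin (top_of_set X) U; U \<noteq> {}; openin (top_of_set X) V; V \<noteq> {}\<rbrakk>
      \<Longrightarrow> \<exists>x\<in>U. \<exists>y\<in>V. \<exists>n\<ge>N. g n x y < e N"
    and distal: "\<And>x y. \<lbrakk>x \<noteq> y; \<And>N. \<exists>n\<ge>N. g n x y < e N\<rbrakk>
      \<Longrightarrow> \<exists>\<delta>>0. \<forall>N. \<exists>n\<ge>N. dist ((T ^^ (r * n)) x) ((T ^^ (s * n)) y) > \<delta>"
  shows "Li_Yorke_chaotic X T r s"
proof -
  define d where "d = (\<lambda>n x y. dist ((T ^^ (r * n)) x) ((T ^^ (s * n)) y))"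
  define P where "P = (\<lambda>N. {(x, y). \<exists>n\<ge>N. d n x y < inverse (Suc N)})"
  define Q where "Q = (\<lambda>N. {(x, y). \<exists>n\<ge>N. g n x y < e N})"
  have d_cont: "continuous_on X (\<lambda>y. d n x y)" "continuous_on X (\<lambda>x. d n x y)" for n x y
    unfolding d_def by (intro continuous_intros continuous_funpow)+
  obtain C where C: "C \<subseteq> X" "uncountable C"
    "\<And>x y R. \<lbrakk>x \<in> C; y \<in> C; x \<noteq> y; R \<in> range P \<union> range Q\<rbrakk> \<Longrightarrow> (x, y) \<in> R"
  proof (rule Mycielski[OF compact_nonempty no_isolated_point, where \<R> = "range P \<union> range Q"])
    fix R x assume "R \<in> range P \<union> range Q" "x \<in> X"
    then show "openin (top_of_set X) {y\<in>X. (x, y) \<in> R}" "openin (top_of_set X) {y\<in>X. (y, x) \<in> R}"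
      using cont by (auto simp: P_def Q_def intro!: openin_ex_less d_cont)
  next
    fix R U V assume "R \<in> range P \<union> range Q"
      and UV: "openin (top_of_set X) U" "U \<noteq> {}" "openin (top_of_set X) V" "V \<noteq> {}"
    then show "\<exists>x\<in>U. \<exists>y\<in>V. (x, y) \<in> R"
      using proximal[OF UV] dense[OF UV] by (auto simp: P_def Q_def d_def)
  qed auto
  have "scrambled_pair T r s x y" if xy: "x \<in> C" "y \<in> C" "x \<noteq> y" for x y
  proof -
    have "(x, y) \<in> P N" "(x, y) \<in> Q N" for N
      using C(3)[OF xy] by simp_all
    then have P: "\<exists>n\<ge>N. d n x y < inverse (Suc N)" and Q: "\<exists>n\<ge>N. g n x y < e N" for N
      unfolding P_def Q_def by blast+
    obtain \<delta> where "\<delta> > 0" "\<And>N. \<exists>n\<ge>N. d n x y > \<delta>"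
      using distal[OF xy(3) Q] unfolding d_def by blast
    then have "liminf (\<lambda>n. ereal (d n x y)) = 0" "limsup (\<lambda>n. ereal (d n x y)) > 0"
      using P by (auto intro!: liminf_eq_zeroI limsup_posI simp: d_def)
    then show ?thesis unfolding scrambled_pair_def d_def by blast
  qed
  then show ?thesis
    using C(1,2) unfolding Li_Yorke_chaotic_def scrambled_set_def by blast
qed

section \<open>The case of distinct exponents\<close>

text \<open>If the two powers agreed on \<open>X\<close>, then \<open>T ^^ (s - r)\<close> would fix
  every point reached after at least \<open>r\<close> steps. A point that has visited
  \<open>A\<close> at such a time could then not visit the disjoint set \<open>B\<close> at a later
  time differing by a multiple of \<open>s - r\<close>.\<close>

lemma funpow_neq:
  assumes "r < s" "r \<ge> 1"
  obtains z where "z \<in> X" "(T ^^ r) z \<noteq> (T ^^ s) z"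
proof (rule ccontr)
  assume "\<not> thesis"
  then have eq: "(T ^^ r) z = (T ^^ s) z" if "z \<in> X" for z
    using \<open>\<And>z. z \<in> X \<Longrightarrow> (T ^^ r) z \<noteq> (T ^^ s) z \<Longrightarrow> thesis\<close> that by blast
  define d where "d = s - r"
  have d: "d \<ge> 1" using assms by (simp add: d_def)
  have fixd: "(T ^^ d) ((T ^^ m) z) = (T ^^ m) z" if "z \<in> X" "m \<ge> r" for z m
  proof -
    have "(T ^^ m) z = (T ^^ (m - r)) ((T ^^ r) z)"
      using that(2) by (simp flip: funpow_add_apply)
    also have "\<dots> = (T ^^ (m - r)) ((T ^^ s) z)" by (simp add: eq[OF that(1)])
    also have "\<dots> = (T ^^ (m - r + s)) z" by (simp add: funpow_add_apply)
    also have "m - r + s = d + m" using that(2) assms(1) by (simp add: d_def)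
    finally have "(T ^^ m) z = (T ^^ (d + m)) z" .
    then show ?thesis unfolding funpow_add_apply by (rule sym)
  qed
  have fixdk: "(T ^^ (d * k)) ((T ^^ m) z) = (T ^^ m) z" if "z \<in> X" "m \<ge> r" for z m k
  proof -
    have "((T ^^ d) ^^ k) ((T ^^ m) z) = (T ^^ m) z"
      by (induction k) (simp_all add: fixd[OF that])
    then show ?thesis by (simp add: funpow_mult)
  qed
  obtain a b where ab: "a \<in> X" "b \<in> X" "a \<noteq> b" using nontrivial by blast
  define e where "e = dist a b / 2"
  have "e > 0" using ab by (simp add: e_def)
  define A B where "A = X \<inter> ball a e" and "B = X \<inter> ball b e"
  have AB: "openin (top_of_set X) A" "openin (top_of_set X) B" "a \<in> A" "b \<in> B"
    using ab \<open>e > 0\<close> by (auto simp: A_def B_def openin_open_Int)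
  have disj: "A \<inter> B = {}"
  proof -
    have "\<not> (dist a x < e \<and> dist b x < e)" for x
      using dist_triangle2[of a b x] by (auto simp: e_def dist_commute)
    then show ?thesis by (auto simp: A_def B_def)
  qed
  \<comment> \<open>The factor \<open>r\<close> makes the visiting time at least \<open>r\<close>,
    as \<open>fixdk\<close> requires; the factor \<open>d\<close> makes it a multiple of
    \<open>d\<close>, so that its difference from \<open>d * m\<close> below is one too.\<close>
  have rd: "r * d \<ge> 1" using assms(2) d by simp
  obtain n x where n: "n \<ge> 1" "x \<in> X" "(T ^^ (r * d * n)) x \<in> A"
    using hits[OF rd openin_X compact_nonempty(2) AB(1), of 0] AB(3) by blast
  define U where "U = {x\<in>X. (T ^^ (r * d * n)) x \<in> A}"
  have U: "openin (top_of_set X) U" "U \<noteq> {}"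
    using openin_preimage[OF openin_X AB(1)] n by (auto simp: U_def)
  obtain m y where m: "m \<ge> r * n" "y \<in> U" "(T ^^ (d * m)) y \<in> B"
    using hits[OF d U AB(2), of "r * n"] AB(4) by blast
  have y: "y \<in> X" "(T ^^ (r * d * n)) y \<in> A" using m(2) by (auto simp: U_def)
  obtain j where "m = r * n + j" using m(1) le_Suc_ex by blast
  then have "d * m = d * j + r * d * n" by (simp add: algebra_simps)
  then have "(T ^^ (d * m)) y = (T ^^ (d * j)) ((T ^^ (r * d * n)) y)"
    by (simp add: funpow_add_apply)
  also have "\<dots> = (T ^^ (r * d * n)) y"
    using d n(1) by (intro fixdk[OF y(1)]) simp
  finally show False using y m(3) disj by auto
qed

text \<open>If both orbits stayed \<open>\<delta>\<close>-close from some time on, then at consecutive times near a point \<open>z\<close>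
  one would get \<open>(T ^^ r) z\<close> and \<open>(T ^^ s) z\<close> close to each other.\<close>

lemma distal_dense:
  assumes "r < s" "r \<ge> 1"
  obtains \<delta> where "\<delta> > 0"
    "\<And>U V N. \<lbrakk>openin (top_of_set X) U; U \<noteq> {}; openin (top_of_set X) V; V \<noteq> {}\<rbrakk>
      \<Longrightarrow> \<exists>x\<in>U. \<exists>y\<in>V. \<exists>n\<ge>N. dist ((T ^^ (r * n)) x) ((T ^^ (s * n)) y) > \<delta>"
proof -
  obtain z where z: "z \<in> X" "(T ^^ r) z \<noteq> (T ^^ s) z" by (rule funpow_neq[OF assms])
  define e where "e = dist ((T ^^ r) z) ((T ^^ s) z) / 3"
  have "e > 0" using z by (simp add: e_def)
  obtain d1 where d1: "d1 > 0" "\<And>x. x \<in> X \<Longrightarrow> dist x z < d1 \<Longrightarrow> dist ((T ^^ r) x) ((T ^^ r) z) < e"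
    using continuous_funpow[of r] z(1) \<open>e > 0\<close> unfolding continuous_on_iff by metis
  obtain d2 where d2: "d2 > 0" "\<And>x. x \<in> X \<Longrightarrow> dist x z < d2 \<Longrightarrow> dist ((T ^^ s) x) ((T ^^ s) z) < e"
    using continuous_funpow[of s] z(1) \<open>e > 0\<close> unfolding continuous_on_iff by metis
  \<comment> \<open>The bound \<open>d2 / 2\<close> lets \<open>b\<close> inherit closeness to
    \<open>z\<close> from \<open>a\<close>; the bound \<open>e\<close> controls the middle one of
    three distances that join \<open>(T ^^ r) z\<close> to \<open>(T ^^ s) z\<close>, which are
    \<open>3 * e\<close> apart.\<close>
  define \<delta> where "\<delta> = min e (d2 / 2)"
  show thesis
  proof
    show "\<delta> > 0" using \<open>e > 0\<close> d2 by (simp add: \<delta>_def)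
    fix U V N assume UV: "openin (top_of_set X) U" "U \<noteq> {}" "openin (top_of_set X) V" "V \<noteq> {}"
    define Z where "Z = X \<inter> ball z (min d1 (d2 / 2))"
    have Z: "openin (top_of_set X) Z" "Z \<noteq> {}"
      using z(1) d1(1) d2(1) by (auto simp: Z_def openin_open_Int)
    obtain n x where n: "n \<ge> N" "x \<in> U" "(T ^^ (r * n)) x \<in> Z"
      using hits[OF assms(2) UV(1,2) Z, of N] by blast
    \<comment> \<open>Only the orbit of \<open>x\<close> is steered towards \<open>z\<close>; any
      \<open>y\<close> in \<open>V\<close> works.\<close>
    obtain y where y: "y \<in> V" using UV by blast
    then have yX: "y \<in> X" using openin_imp_subset[OF UV(3)] by blast
    define a b where "a = (T ^^ (r * n)) x" and "b = (T ^^ (s * n)) y"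
    have a: "a \<in> X" "dist a z < d1" "dist a z < d2 / 2"
      using n(3) by (auto simp: Z_def a_def dist_commute)
    have b: "b \<in> X" using yX funpow_in by (simp add: b_def)
    have Suc: "(T ^^ (r * Suc n)) x = (T ^^ r) a" "(T ^^ (s * Suc n)) y = (T ^^ s) b"
      by (simp_all add: a_def b_def funpow_add)
    have "dist a b > \<delta> \<or> dist ((T ^^ r) a) ((T ^^ s) b) > \<delta>"
    proof (rule ccontr)
      assume "\<not> ?thesis"
      then have le: "dist a b \<le> d2 / 2" "dist ((T ^^ r) a) ((T ^^ s) b) \<le> e"
        by (auto simp: \<delta>_def)
      have "dist b z < d2" using a(3) le(1) dist_triangle[of b z a] by (simp add: dist_commute)
      then have "dist ((T ^^ s) b) ((T ^^ s) z) < e" using d2(2) b by blast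
      moreover have "dist ((T ^^ r) a) ((T ^^ r) z) < e" using d1(2) a by blast
      ultimately have "dist ((T ^^ r) z) ((T ^^ s) z) < 3 * e"
        using le(2) dist_triangle[of "(T ^^ r) z" "(T ^^ s) z" "(T ^^ r) a"]
          dist_triangle[of "(T ^^ r) a" "(T ^^ s) z" "(T ^^ s) b"]
        by (simp add: dist_commute)
      then show False by (simp add: e_def)
    qed
    then have "\<exists>n\<ge>N. dist ((T ^^ (r * n)) x) ((T ^^ (s * n)) y) > \<delta>"
      using n(1) Suc a_def b_def by (metis le_SucI)
    then show "\<exists>x\<in>U. \<exists>y\<in>V. \<exists>n\<ge>N. dist ((T ^^ (r * n)) x) ((T ^^ (s * n)) y) > \<delta>"
      using n(2) y by blast
  qed
qed

lemma proximal_dense_neq: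
  assumes "r < s" "e > 0"
    and "openin (top_of_set X) U" "U \<noteq> {}" "openin (top_of_set X) V" "V \<noteq> {}"
  shows "\<exists>x\<in>U. \<exists>y\<in>V. \<exists>n\<ge>N. dist ((T ^^ (r * n)) x) ((T ^^ (s * n)) y) < e"
proof -
  have "s - r \<ge> 1" using assms(1) by simp
  then obtain n y where n: "n \<ge> N" "y \<in> V" "(T ^^ ((s - r) * n)) y \<in> U"
    using hits[OF _ assms(5,6,3,4), of "s - r" N] by blast
  have "s * n = r * n + (s - r) * n"
    using assms(1) by (simp flip: distrib_right)
  then have "(T ^^ (r * n)) ((T ^^ ((s - r) * n)) y) = (T ^^ (s * n)) y"
    by (simp add: funpow_add)
  then show ?thesis using n \<open>e > 0\<close> by force
qed

lemma Li_Yorke_chaotic_less: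
  assumes "r < s" "r \<ge> 1"
  shows "Li_Yorke_chaotic X T r s"
proof -
  obtain \<delta> where \<delta>: "\<delta> > 0" "\<And>U V N. \<lbrakk>openin (top_of_set X) U; U \<noteq> {};
      openin (top_of_set X) V; V \<noteq> {}\<rbrakk>
      \<Longrightarrow> \<exists>x\<in>U. \<exists>y\<in>V. \<exists>n\<ge>N. dist ((T ^^ (r * n)) x) ((T ^^ (s * n)) y) > \<delta>"
    by (rule distal_dense[OF assms]) blast
  show ?thesis
  proof (rule Li_Yorke_chaoticI)
    \<comment> \<open>The criterion is used with \<open>g\<close> the negated distance and
      \<open>e\<close> constantly \<open>- \<delta>\<close>.\<close>
    show "continuous_on X (\<lambda>y. - dist ((T ^^ (r * n)) x) ((T ^^ (s * n)) y))"
      "continuous_on X (\<lambda>x. - dist ((T ^^ (r * n)) x) ((T ^^ (s * n)) y))" for n x y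
      by (intro continuous_intros continuous_funpow)+
  next
    fix U V N assume "openin (top_of_set X) U" "U \<noteq> {}" "openin (top_of_set X) V" "V \<noteq> {}"
    note UV = this
    show "\<exists>x\<in>U. \<exists>y\<in>V. \<exists>n\<ge>N. dist ((T ^^ (r * n)) x) ((T ^^ (s * n)) y) < inverse (Suc N)"
      by (rule proximal_dense_neq[OF assms(1) _ UV]) simp
    show "\<exists>x\<in>U. \<exists>y\<in>V. \<exists>n\<ge>N. - dist ((T ^^ (r * n)) x) ((T ^^ (s * n)) y) < - \<delta>"
      using \<delta>(2)[OF UV] by simp
  next
    fix x y
    assume "\<And>N. \<exists>n\<ge>N. - dist ((T ^^ (r * n)) x) ((T ^^ (s * n)) y) < - \<delta>"
    then show "\<exists>\<delta>>0. \<forall>N. \<exists>n\<ge>N. dist ((T ^^ (r * n)) x) ((T ^^ (s * n)) y) > \<delta>"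
      using \<delta>(1) by (intro exI[of _ \<delta>]) simp
  qed
qed

section \<open>Exchanging the exponents, and the case of equal exponents\<close>

text \<open>Exchanging \<open>r\<close> and \<open>s\<close> amounts to exchanging the two points,
  and a scrambled set is tested on both orders of each pair.\<close>

lemma Li_Yorke_chaotic_sym:
  assumes "Li_Yorke_chaotic X T r s"
  shows "Li_Yorke_chaotic X T s r"
proof -
  have "scrambled_pair T r s x y = scrambled_pair T s r y x" for x y
    by (simp add: scrambled_pair_def dist_commute)
  then show ?thesis
    using assms unfolding Li_Yorke_chaotic_def scrambled_set_def by metis
qed

text \<open>For \<open>r = s\<close> no uniform separation constant can be expected: the system may have
  equicontinuity points. Recurrence of the pair \<open>(x, y)\<close> bounds the limit superior by \<open>dist x y\<close>
  from below instead.\<close>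

lemma recurrent_dense:
  assumes "r \<ge> 1" "e > 0"
    and UV: "openin (top_of_set X) U" "U \<noteq> {}" "openin (top_of_set X) V" "V \<noteq> {}"
  shows "\<exists>x\<in>U. \<exists>y\<in>V. \<exists>n\<ge>N. dist ((T ^^ (r * n)) x) x + dist ((T ^^ (r * n)) y) y < e"
proof -
  obtain k u where k: "u \<in> U" "(T ^^ (1 * k)) u \<in> V"
    using hits[OF order_refl UV, of 0] by blast
  have uX: "u \<in> X" using k(1) openin_imp_subset[OF UV(1)] by blast
  define A where "A = U \<inter> ball u (e / 4)"
  define B where "B = V \<inter> ball ((T ^^ k) u) (e / 4)"
  \<comment> \<open>With \<open>y\<close> chosen as \<open>(T ^^ k) x\<close>, a single return of
    \<open>x\<close> to \<open>W\<close> makes both points return at the same time. The radii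
    \<open>e / 4\<close> keep each displacement below \<open>e / 2\<close>.\<close>
  define W where "W = {x\<in>A. (T ^^ k) x \<in> B}"
  have "openin (top_of_set X) W"
    unfolding W_def A_def B_def by (intro openin_preimage openin_ball_Int UV)
  moreover have "u \<in> W" using k \<open>e > 0\<close> by (simp add: W_def A_def B_def)
  ultimately obtain n x where n: "n \<ge> N" "x \<in> W" "(T ^^ (r * n)) x \<in> W"
    using hits[OF assms(1), of W W N] by blast
  define y where "y = (T ^^ k) x"
  have y: "(T ^^ (r * n)) y = (T ^^ k) ((T ^^ (r * n)) x)"
    by (simp add: y_def add.commute flip: funpow_add_apply)
  have "dist ((T ^^ (r * n)) x) x < e / 2"
    by (rule dist_triangle_half_r[of u]) (use n(2,3) in \<open>auto simp: W_def A_def\<close>)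
  moreover have "dist ((T ^^ (r * n)) y) y < e / 2"
    unfolding y unfolding y_def
    by (rule dist_triangle_half_r[of "(T ^^ k) u"]) (use n(2,3) in \<open>auto simp: W_def B_def\<close>)
  moreover have "x \<in> U" "y \<in> V" using n by (auto simp: W_def A_def B_def y_def)
  ultimately show ?thesis using n(1) by force
qed

lemma proximal_dense_eq:
  assumes "r \<ge> 1" "e > 0" and Y: "subsystem Y X T" "transitive_system (X \<times> Y) (map_prod T T)"
    and UV: "openin (top_of_set X) U" "U \<noteq> {}" "openin (top_of_set X) V" "V \<noteq> {}"
  shows "\<exists>x\<in>U. \<exists>y\<in>V. \<exists>n\<ge>N. dist ((T ^^ (r * n)) x) ((T ^^ (r * n)) y) < e"
proof -
  obtain p where p: "p \<in> Y" and YX: "Y \<subseteq> X"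
    using Y(1) by (auto simp: subsystem_def dest: closedin_imp_subset)
  \<comment> \<open>Pairing both \<open>U\<close> and \<open>V\<close> with the same small set
    \<open>W\<close> forces \<open>W\<close> to return to itself at the very time at which
    \<open>U\<close> meets \<open>V\<close>.\<close>
  define W where "W = Y \<inter> ball p (e / 2)"
  have W: "openin (top_of_set Y) W" "p \<in> W"
    using p \<open>e > 0\<close> by (auto simp: W_def openin_open_Int)
  have "openin (top_of_set (X \<times> Y)) (U \<times> W)" "openin (top_of_set (X \<times> Y)) (V \<times> W)"
    using UV W by (auto intro: openin_Times)
  moreover have "U \<times> W \<noteq> {}" "V \<times> W \<noteq> {}" using UV W by auto
  ultimately obtain k where "(U \<times> W) \<inter> (map_prod T T ^^ k) -` (V \<times> W) \<noteq> {}"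
    using Y(2) unfolding transitive_system_def by meson
  then obtain u w where k: "u \<in> U" "(T ^^ k) u \<in> V" "w \<in> W" "(T ^^ k) w \<in> W"
    by (auto simp: map_prod_funpow)
  define A where "A = {x\<in>U. (T ^^ k) x \<in> V}"
  have A: "openin (top_of_set X) A" "A \<noteq> {}"
    using openin_preimage[OF UV(1,3)] k by (auto simp: A_def)
  \<comment> \<open>These points are moved by less than \<open>e\<close> under
    \<open>T ^^ k\<close>. The set is open in \<open>X\<close> and contains \<open>w\<close>, so it
    is a legitimate target for orbits starting in \<open>A\<close>.\<close>
  define Z where "Z = X \<inter> (\<lambda>z. dist z ((T ^^ k) z)) -` {..<e}"
  have "openin (top_of_set X) Z"
    unfolding Z_def by (intro continuous_openin_preimage_gen continuous_intros continuous_funpow)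
  moreover have "dist w ((T ^^ k) w) < e"
    by (rule dist_triangle_half_r[of p]) (use k(3,4) in \<open>auto simp: W_def\<close>)
  then have "w \<in> Z" using k(3) YX by (auto simp: Z_def W_def)
  ultimately obtain n x where n: "n \<ge> N" "x \<in> A" "(T ^^ (r * n)) x \<in> Z"
    using hits[OF assms(1) A, of Z N] by blast
  \<comment> \<open>Since iterates commute, the displacement of \<open>(T ^^ (r * n)) x\<close>
    under \<open>T ^^ k\<close> is the distance between the orbits of \<open>x\<close> and
    \<open>y = (T ^^ k) x\<close> at time \<open>r * n\<close>.\<close>
  have "(T ^^ (r * n)) ((T ^^ k) x) = (T ^^ k) ((T ^^ (r * n)) x)"
    by (simp add: add.commute flip: funpow_add_apply)
  then show ?thesis using n by (force simp: Z_def A_def)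
qed

lemma Li_Yorke_chaotic_eq:
  assumes "r \<ge> 1" and Y: "subsystem Y X T" "transitive_system (X \<times> Y) (map_prod T T)"
  shows "Li_Yorke_chaotic X T r r"
proof (rule Li_Yorke_chaoticI)
  let ?d = "\<lambda>n x y. dist ((T ^^ (r * n)) x) ((T ^^ (r * n)) y)"
  let ?\<rho> = "\<lambda>n x y. dist ((T ^^ (r * n)) x) x + dist ((T ^^ (r * n)) y) y"
  show "continuous_on X (\<lambda>y. ?\<rho> n x y)" "continuous_on X (\<lambda>x. ?\<rho> n x y)" for n x y
    by (intro continuous_intros continuous_funpow)+
  show "\<exists>x\<in>U. \<exists>y\<in>V. \<exists>n\<ge>N. ?d n x y < inverse (Suc N)"
    "\<exists>x\<in>U. \<exists>y\<in>V. \<exists>n\<ge>N. ?\<rho> n x y < inverse (Suc N)"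
    if UV: "openin (top_of_set X) U" "U \<noteq> {}" "openin (top_of_set X) V" "V \<noteq> {}" for U V N
    by (rule proximal_dense_eq[OF assms(1) _ Y UV] recurrent_dense[OF assms(1) _ UV], simp)+
  fix x y :: 'a assume "x \<noteq> y" and rec: "\<And>N. \<exists>n\<ge>N. ?\<rho> n x y < inverse (Suc N)"
  obtain K where K: "inverse (Suc K) < dist x y / 2"
    using reals_Archimedean[of "dist x y / 2"] \<open>x \<noteq> y\<close> by auto
  have "\<exists>n\<ge>N. ?d n x y > dist x y / 2" for N
  proof -
    \<comment> \<open>Beyond \<open>K\<close> the total recurrence error is below half of
      \<open>dist x y\<close>, so more than the other half survives at time
      \<open>n\<close>.\<close>
    obtain n where n: "n \<ge> max N K" "?\<rho> n x y < inverse (Suc (max N K))" using rec by blast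
    have "inverse (Suc (max N K)) \<le> inverse (real (Suc K))"
      by (intro le_imp_inverse_le) auto
    moreover have "dist x y \<le> ?\<rho> n x y + ?d n x y"
      using dist_triangle[of x y "(T ^^ (r * n)) x"]
        dist_triangle[of "(T ^^ (r * n)) x" y "(T ^^ (r * n)) y"]
      by (simp add: dist_commute)
    ultimately have "?d n x y > dist x y / 2" using n(2) K by linarith
    then show ?thesis using n(1) by (intro exI[of _ n]) simp
  qed
  then show "\<exists>\<delta>>0. \<forall>N. \<exists>n\<ge>N. ?d n x y > \<delta>"
    using \<open>x \<noteq> y\<close> by (intro exI[of _ "dist x y / 2"]) simp
qed

end

theorem corollary6p9:
  fixes X :: "'a::metric_space set" and T :: "'a \<Rightarrow> 'a"
  assumes "dynamical_system X T"
    and "\<exists>x\<in>X. \<exists>y\<in>X. x \<noteq> y"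
    and "totally_transitive_system X T"
    and "\<exists>Y. subsystem Y X T \<and> transitive_system (X \<times> Y) (map_prod T T)"
  shows "nonclassical_Li_Yorke_chaotic X T"
proof -
  interpret tt_system X T
    using assms(1-3) by unfold_locales
  \<comment> \<open>The subsystem enters only for \<open>r = s\<close>; the case
    \<open>s < r\<close> follows from \<open>r < s\<close> by exchanging exponents.\<close>
  have "Li_Yorke_chaotic X T r s" if "r \<ge> 1" "s \<ge> 1" for r s
    using that assms(4) Li_Yorke_chaotic_less Li_Yorke_chaotic_eq Li_Yorke_chaotic_sym
    by (metis linorder_less_linear)
  then show ?thesis by (simp add: nonclassical_Li_Yorke_chaotic_def)
qed

end
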